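(* For every $\lambda\in(-4,0)\cup(0,4)$ and every $\alpha>1$, there exist a real-valued potential $V:\mathbb Z^2\to\mathbb R$, a constant $C_{\alpha,\lambda}>0$, and a nonzero function $u$ on $\mathbb Z^2$ such that for all $n\in\mathbb Z^2$ $$|u(n)|\le\langle n\rangle^{-\alpha},\qquad |V(n)|\le C_{\alpha,\lambda}\langle n\rangle^{-1},$$ and $(\Delta+V)u=\lambda u$. In particular, $u\in\ell^2(\mathbb Z^2)$, and hence $\lambda$ is an eigenvalue of $\Delta+V$ on $\ell^2(\mathbb Z^2)$.
   Context: For $n\in\mathbb Z^2$, $|n|=(n_1^2+n_2^2)^{1/2}$ and $\langle n\rangle=(1+|n|^2)^{1/2}$. $\Delta$ is the (uncentered) nearest-neighbor adjacency operator $(\Delta u)(n)=\sum_{j=1}^2\bigl(u(n+e_j)+u(n-e_j)\bigr)$, with $e_1,e_2$ the standard basis vectors, and $V$ acts by multiplication: $(Vu)(n)=V(n)u(n)$. *)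

theory Defs
  imports "HOL-Analysis.Analysis"
begin

type_synonym lattice = "int \<times> int"

definition euclid_norm :: "lattice \<Rightarrow> real" where
  "euclid_norm n = sqrt (of_int (fst n) ^ 2 + of_int (snd n) ^ 2)"

definition bracket :: "lattice \<Rightarrow> real" where
  "bracket n = sqrt (1 + euclid_norm n ^ 2)"

definition unit_vec :: "nat \<Rightarrow> lattice" where
  "unit_vec j = (if j = 1 then (1, 0) else (0, 1))"

definition adjacency :: "(lattice \<Rightarrow> complex) \<Rightarrow> lattice \<Rightarrow> complex" where
  "adjacency u n = (\<Sum>j\<in>{1, 2}. u (n + unit_vec j) + u (n - unit_vec j))"

definition schroedinger :: "(lattice \<Rightarrow> real) \<Rightarrow> (lattice \<Rightarrow> complex) \<Rightarrow> lattice \<Rightarrow> complex" where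
  "schroedinger V u = (\<lambda>n. adjacency u n + of_real (V n) * u n)"

definition ell2 :: "(lattice \<Rightarrow> complex) set" where
  "ell2 = {u. (\<lambda>n. (cmod (u n))\<^sup>2) summable_on UNIV}"

text \<open>Operators are given on arbitrary functions on the lattice; the first conjunct says
  that \<open>T\<close> restricts to an everywhere defined operator on the Hilbert space.\<close>

definition eigenvalue_on_ell2 ::
  "((lattice \<Rightarrow> complex) \<Rightarrow> lattice \<Rightarrow> complex) \<Rightarrow> complex \<Rightarrow> bool" where
  "eigenvalue_on_ell2 T \<mu> \<longleftrightarrow>
     (\<forall>u\<in>ell2. T u \<in> ell2) \<and>
     (\<exists>u\<in>ell2. u \<noteq> (\<lambda>n. 0) \<and> T u = (\<lambda>n. \<mu> * u n))"

end

theory Submission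
  imports Defs
begin

text \<open>
  Take a plane wave \<open>c n = cos (p n\<^sub>1 + q n\<^sub>2)\<close> with \<open>2 cos p + 2 cos q = \<lambda>\<close> and damp it by
  \<open>\<rho> n = (R + |n|)\<^sup>-\<^sup>m\<close>. Since \<open>\<rho>\<close> varies by a relative amount \<open>O(1/|n|)\<close> between neighbors, the
  residual of \<open>\<rho> c\<close> in the eigenvalue equation is \<open>O(\<rho>/|n|)\<close>, and dividing it by \<open>\<rho> c\<close> yields an
  admissible potential except at the sites where \<open>|c| < \<epsilon>\<close>. For \<open>\<lambda> \<noteq> 0\<close> the phases can be chosen
  such that \<open>p\<close>, \<open>2 p\<close>, \<open>p + q\<close> and \<open>p - q\<close> are not multiples of \<open>\<pi>\<close>. Then, for small \<open>\<epsilon>\<close>, the right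
  neighbor of an exceptional site is neither exceptional nor adjacent to another exceptional site,
  so changing the function there by \<open>O(\<rho>/|n|)\<close> makes the residual at the exceptional site vanish,
  and the potential can be taken to be zero there.
\<close>

section \<open>The adjacency operator on real functions\<close>

text \<open>The whole construction is real; complex values enter only when the final function is
  embedded.\<close>

definition lap :: "(lattice \<Rightarrow> real) \<Rightarrow> lattice \<Rightarrow> real" where
  "lap f n = f (n + (1,0)) + f (n - (1,0)) + f (n + (0,1)) + f (n - (0,1))"

lemma adjacency_of_real:
  "adjacency (\<lambda>n. of_real (f n)) n = of_real (lap f n)"
  by (simp add: adjacency_def unit_vec_def lap_def)

text \<open>Writing all four neighbors as \<open>n + d\<close> lets the one-step estimates below,
  stated for \<open>n + d\<close>, apply uniformly.\<close>

lemma lap_plus: "lap f n = f (n + (1,0)) + f (n + (-1,0)) + f (n + (0,1)) + f (n + (0,-1))"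
  by (cases n) (simp add: lap_def)

lemma lap_add: "lap (\<lambda>n. f n + g n) n = lap f n + lap g n"
  by (simp add: lap_def)

section \<open>Choice of phases and separation of the small values of the cosine\<close>

text \<open>Split \<open>lam / 2\<close> into two unequal cosines \<open>x\<close> and
  \<open>y\<close>. Then \<open>sin (2 * p)\<close> is nonzero because \<open>x\<close> is, and
  \<open>sin (p + q) * sin (p - q) = y^2 - x^2 = - lam * t\<close>, which is where
  \<open>lam \<noteq> 0\<close> enters.\<close>

lemma exists_phases:
  fixes lam :: real
  assumes "lam \<in> {-4<..<0} \<union> {0<..<4}"
  obtains p q where "2 * cos p + 2 * cos q = lam" "sin p \<noteq> 0" "sin (2 * p) \<noteq> 0"
    "sin (p + q) \<noteq> 0" "sin (p - q) \<noteq> 0"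
proof -
  \<comment> \<open>Small enough to keep both cosines inside (-1,1) and to give \<open>x\<close> the
    sign of \<open>lam\<close>.\<close>
  define t where "t = min \<bar>lam\<bar> (4 - \<bar>lam\<bar>) / 8"
  define x where "x = lam / 4 + t"
  define y where "y = lam / 4 - t"
  have t: "t > 0" and "t < \<bar>lam\<bar> / 4" "t < 1 - \<bar>lam\<bar> / 4"
    using assms by (auto simp: t_def)
  then have xy: "\<bar>x\<bar> < 1" "\<bar>y\<bar> < 1" "x \<noteq> 0"
    by (auto simp: x_def y_def)
  have "x^2 - y^2 = lam * t"
    by (simp add: x_def y_def power2_eq_square algebra_simps)
  then have ne: "x^2 \<noteq> y^2"
    using t assms by auto
  define p where "p = arccos x"
  define q where "q = arccos y"
  have cp: "cos p = x" and cq: "cos q = y"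
    using xy by (auto simp: p_def q_def)
  have sp2: "(sin p)^2 = 1 - x^2" and sq2: "(sin q)^2 = 1 - y^2"
    using cp cq sin_squared_eq by metis+
  have "x^2 < 1"
    using xy by (simp add: abs_square_less_1)
  with sp2 have sp: "sin p \<noteq> 0" by auto
  have "sin (p + q) * sin (p - q) = (sin p)^2 * (cos q)^2 - (cos p)^2 * (sin q)^2"
    by (simp add: sin_add sin_diff power2_eq_square algebra_simps)
  also have "\<dots> = y^2 - x^2"
    unfolding cp cq sp2 sq2 by (simp add: algebra_simps)
  finally have "sin (p + q) * sin (p - q) \<noteq> 0"
    using ne by simp
  then show ?thesis
    using that[of p q] sp cp cq xy by (auto simp: sin_double x_def y_def)
qed

text \<open>Where the cosine is small, the sine is at least 1/2 in absolute value, so in the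
  addition formula the sine term contributes at least \<open>2 * \<epsilon>\<close> and the cosine
  term takes away at most \<open>\<epsilon>\<close>.\<close>

lemma abs_cos_add_ge:
  fixes x d \<epsilon> :: real
  assumes "\<bar>cos x\<bar> < \<epsilon>" "\<epsilon> \<le> 1/2" "4 * \<epsilon> \<le> \<bar>sin d\<bar>"
  shows "\<epsilon> \<le> \<bar>cos (x + d)\<bar>"
proof -
  have "\<bar>cos x\<bar>^2 \<le> (1/2)^2"
    by (rule power_mono) (use assms in auto)
  then have "(1/2)^2 \<le> \<bar>sin x\<bar>^2"
    using sin_cos_squared_add[of x] by (simp add: power2_eq_square)
  then have s: "1/2 \<le> \<bar>sin x\<bar>"
    by (rule power2_le_imp_le) simp
  have "(1/2) * (4 * \<epsilon>) \<le> \<bar>sin x\<bar> * \<bar>sin d\<bar>"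
    by (rule mult_mono) (use s assms in auto)
  moreover have "\<bar>cos x * cos d\<bar> \<le> \<bar>cos x\<bar>"
    by (simp add: abs_mult mult_left_le)
  moreover have "\<bar>sin x * sin d\<bar> - \<bar>cos x * cos d\<bar> \<le> \<bar>cos (x + d)\<bar>"
    by (simp add: cos_add)
  ultimately show ?thesis
    using assms by (simp add: abs_mult)
qed

section \<open>Variation of the damping factor between neighboring sites\<close>

lemma euclid_norm_unit_step:
  assumes "d \<in> {(1,0), (-1,0), (0,1), (0,-1)}"
  shows "\<bar>euclid_norm (n + d) - euclid_norm n\<bar> \<le> 1"
proof -
  let ?e = "\<lambda>n :: lattice. (real_of_int (fst n), real_of_int (snd n))"
  have e: "euclid_norm k = norm (?e k)" for k
    by (simp add: euclid_norm_def norm_Pair)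
  have "\<bar>norm (?e (n + d)) - norm (?e n)\<bar> \<le> norm (?e (n + d) - ?e n)"
    by (rule norm_triangle_ineq3)
  also have "\<dots> = 1"
    using assms by (auto simp: norm_Pair)
  finally show ?thesis
    by (simp add: e)
qed

lemma abs_power_minus_one_le:
  fixes x :: real
  assumes "0 \<le> x" "x \<le> 2"
  shows "\<bar>x ^ m - 1\<bar> \<le> real m * 2 ^ m * \<bar>x - 1\<bar>"
proof (induction m)
  case (Suc m)
  have "x ^ Suc m - 1 = x * (x ^ m - 1) + (x - 1)"
    by (simp add: algebra_simps)
  then have "\<bar>x ^ Suc m - 1\<bar> \<le> x * \<bar>x ^ m - 1\<bar> + \<bar>x - 1\<bar>"
    using abs_triangle_ineq[of "x * (x ^ m - 1)" "x - 1"] assms by (simp add: abs_mult)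
  also have "\<dots> \<le> 2 * (m * 2 ^ m * \<bar>x - 1\<bar>) + 2 ^ Suc m * \<bar>x - 1\<bar>"
    using assms Suc one_le_power[of "2::real" "Suc m"]
    by (intro add_mono mult_mono) (auto simp: mult_le_cancel_right1)
  finally show ?case
    by (simp add: algebra_simps)
qed simp

text \<open>Here \<open>a\<close> and \<open>b\<close> stand for \<open>R + |n|\<close> at
  neighboring sites. From \<open>a \<ge> 2\<close> follows \<open>b \<ge> a / 2\<close>, so the
  ratio \<open>a / b\<close> lies in [0,2] and differs from 1 by at most \<open>2 / a\<close>; this
  is the extra decay gained by a difference.\<close>

lemma inverse_power_step:
  fixes a b :: real
  assumes "2 \<le> a" "\<bar>b - a\<bar> \<le> 1"
  shows "1 / b ^ m \<le> 2 ^ m / a ^ m"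
    and "\<bar>1 / b ^ m - 1 / a ^ m\<bar> \<le> (real m * 2 ^ Suc m) / a ^ Suc m"
proof -
  define x where "x = a / b"
  have b: "b > 0" "a \<le> 2 * b" using assms by auto
  have x: "0 \<le> x" "x \<le> 2"
    using b assms by (auto simp: x_def field_simps)
  have eq: "1 / b ^ m = x ^ m / a ^ m"
    using assms b by (simp add: x_def power_divide)
  have "x ^ m \<le> 2 ^ m"
    using x by (intro power_mono) auto
  then show "1 / b ^ m \<le> 2 ^ m / a ^ m"
    unfolding eq using assms by (intro divide_right_mono) auto
  have "\<bar>x - 1\<bar> = \<bar>b - a\<bar> / b"
    using b by (simp add: x_def divide_simps abs_minus_commute)
  also have "\<dots> \<le> 1 / b"
    using assms b by (intro divide_right_mono) auto
  also have "\<dots> \<le> 2 / a"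
    using assms b by (simp add: field_simps)
  finally have "real m * 2 ^ m * \<bar>x - 1\<bar> \<le> real m * 2 ^ m * (2 / a)"
    by (intro mult_left_mono) auto
  then have "\<bar>x ^ m - 1\<bar> \<le> real m * 2 ^ m * (2 / a)"
    using abs_power_minus_one_le[OF x, of m] by linarith
  then have "\<bar>x ^ m - 1\<bar> / a ^ m \<le> real m * 2 ^ m * (2 / a) / a ^ m"
    using assms by (intro divide_right_mono) auto
  moreover have "1 / b ^ m - 1 / a ^ m = (x ^ m - 1) / a ^ m"
    unfolding eq by (simp add: diff_divide_distrib)
  ultimately show "\<bar>1 / b ^ m - 1 / a ^ m\<bar> \<le> (real m * 2 ^ Suc m) / a ^ Suc m"
    using assms by (simp add: abs_mult mult.commute mult.left_commute)
qed

lemma bracket_eq: "bracket n = sqrt (1 + (of_int (fst n))\<^sup>2 + (of_int (snd n))\<^sup>2)"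
  by (simp add: bracket_def euclid_norm_def add.assoc)

lemma bracket_ge_1: "bracket n \<ge> 1"
  by (simp add: bracket_eq)

lemma bracket_le_add_euclid_norm:
  assumes "1 \<le> R"
  shows "bracket n \<le> R + euclid_norm n"
proof -
  have nn: "euclid_norm n \<ge> 0" by (simp add: euclid_norm_def)
  then have "1 * 1 \<le> R * R" "0 \<le> R * euclid_norm n"
    using assms mult_mono[of 1 R 1 R] by auto
  then show ?thesis
    unfolding bracket_def using nn assms
    by (intro real_le_lsqrt) (auto simp: power2_eq_square algebra_simps intro: add_increasing2)
qed

subsection \<open>Square-summable functions on the lattice\<close>

text \<open>Comparison with inverse squares on the naturals, carried to both half lines by
  reindexing.\<close>

lemma summable_on_int_inverse_square: "(\<lambda>x::int. 1 / (1 + (of_int x)\<^sup>2) :: real) summable_on UNIV"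
proof -
  let ?f = "\<lambda>x::int. 1 / (1 + (of_int x)\<^sup>2) :: real"
  have "summable (\<lambda>n. ?f (int n))"
  proof (rule summable_comparison_test)
    show "summable (\<lambda>n. 2 * inverse ((real (Suc n))^2))"
      using inverse_power_summable[of 2, where 'a = real]
      by (intro summable_mult) (subst summable_Suc_iff, simp)
    have "norm (?f (int n)) \<le> 2 * inverse ((real (Suc n))^2)" for n
    proof -
      have "(1 + real n)^2 \<le> 2 * (1 + (real n)^2)"
        using zero_le_power2[of "1 - real n"] by (simp add: power2_eq_square algebra_simps)
      then show ?thesis
        by (simp add: divide_simps add_pos_nonneg)
    qed
    then show "\<exists>N. \<forall>n\<ge>N. norm (?f (int n)) \<le> 2 * inverse ((real (Suc n))^2)"
      by blast
  qed
  then have s: "(\<lambda>n. ?f (int n)) summable_on UNIV"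
    by (intro norm_summable_imp_summable_on) auto
  have p: "?f summable_on range int"
    using s by (subst summable_on_reindex) (auto simp: o_def)
  have "?f summable_on range (\<lambda>n. - int n)"
    using s by (subst summable_on_reindex) (auto simp: o_def inj_on_def)
  moreover have "range int \<union> range (\<lambda>n. - int n) = UNIV"
    by (auto simp: image_iff) (metis int_cases2)
  ultimately show ?thesis
    using summable_on_union[OF p] by metis
qed

text \<open>The bound \<open>bracket n ^ 4 \<ge> (1 + x^2) * (1 + y^2)\<close> reduces the sum to a
  product of one-dimensional series.\<close>

lemma summable_on_bracket: "(\<lambda>n. 1 / bracket n ^ 4) summable_on UNIV"
proof -
  let ?h = "\<lambda>x::int. 1 / (1 + (of_int x)\<^sup>2) :: real"
  have "(\<lambda>(x, y). ?h x * ?h y) summable_on (UNIV \<times> UNIV)"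
  proof (rule summable_on_SigmaI)
    show "((\<lambda>y. case (x, y) of (x, y) \<Rightarrow> ?h x * ?h y) has_sum ?h x * infsum ?h UNIV) UNIV" for x
      unfolding prod.case
      by (intro has_sum_cmult_right has_sum_infsum summable_on_int_inverse_square)
    show "(\<lambda>x. ?h x * infsum ?h UNIV) summable_on UNIV"
      by (intro summable_on_cmult_left summable_on_int_inverse_square)
  qed auto
  then show ?thesis
    unfolding UNIV_Times_UNIV
  proof (rule summable_on_comparison_test, goal_cases)
    case (1 n)
    obtain x y where n: "n = (x, y)" by force
    let ?X = "(real_of_int x)\<^sup>2" and ?Y = "(real_of_int y)\<^sup>2"
    have "bracket n ^ 4 = (bracket n ^ 2) ^ 2"
      by simp
    also have "\<dots> = (1 + ?X + ?Y) * (1 + ?X + ?Y)"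
      by (simp add: bracket_eq n power2_eq_square[of "1 + ?X + ?Y"])
    also have "\<dots> \<ge> (1 + ?X) * (1 + ?Y)"
      by (intro mult_mono) auto
    finally show ?case
      by (simp add: n frac_le add_pos_nonneg)
  qed auto
qed

lemma ell2_add:
  assumes "u \<in> ell2" "v \<in> ell2"
  shows "(\<lambda>n. u n + v n) \<in> ell2"
proof -
  have "(\<lambda>n. 2 * (cmod (u n))\<^sup>2 + 2 * (cmod (v n))\<^sup>2) summable_on UNIV"
    using assms by (intro summable_on_add summable_on_cmult_right) (auto simp: ell2_def)
  then have "(\<lambda>n. (cmod (u n + v n))\<^sup>2) summable_on UNIV"
  proof (rule summable_on_comparison_test)
    fix n
    have "(cmod (u n + v n))\<^sup>2 \<le> (cmod (u n) + cmod (v n))\<^sup>2"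
      by (intro power_mono norm_triangle_ineq) auto
    also have "\<dots> \<le> 2 * (cmod (u n))\<^sup>2 + 2 * (cmod (v n))\<^sup>2"
      using zero_le_power2[of "cmod (u n) - cmod (v n)"] by (simp add: power2_eq_square algebra_simps)
    finally show "(cmod (u n + v n))\<^sup>2 \<le> 2 * (cmod (u n))\<^sup>2 + 2 * (cmod (v n))\<^sup>2" .
  qed auto
  then show ?thesis by (simp add: ell2_def)
qed

lemma ell2_shift:
  assumes "u \<in> ell2"
  shows "(\<lambda>n. u (n + d)) \<in> ell2"
proof -
  have "(\<lambda>n. (cmod (u n))\<^sup>2) summable_on range (\<lambda>n. n + d)"
    using assms by (simp add: ell2_def)
  then have "((\<lambda>n. (cmod (u n))\<^sup>2) \<circ> (\<lambda>n. n + d)) summable_on UNIV"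
    by (subst (asm) summable_on_reindex) (auto simp: inj_on_def)
  then show ?thesis
    by (simp add: ell2_def o_def)
qed

lemma ell2_bounded_mult:
  assumes "u \<in> ell2" and V: "\<And>n. \<bar>V n\<bar> \<le> C"
  shows "(\<lambda>n. of_real (V n) * u n) \<in> ell2"
proof -
  have "(\<lambda>n. C\<^sup>2 * (cmod (u n))\<^sup>2) summable_on UNIV"
    using assms(1) by (intro summable_on_cmult_right) (auto simp: ell2_def)
  then have "(\<lambda>n. (cmod (of_real (V n) * u n))\<^sup>2) summable_on UNIV"
  proof (rule summable_on_comparison_test)
    fix n
    have "\<bar>V n\<bar>\<^sup>2 \<le> C\<^sup>2"
      by (intro power_mono V) auto
    then show "(cmod (of_real (V n) * u n))\<^sup>2 \<le> C\<^sup>2 * (cmod (u n))\<^sup>2"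
      by (simp add: norm_mult power_mult_distrib mult_right_mono)
  qed auto
  then show ?thesis by (simp add: ell2_def)
qed

text \<open>Supplies the first conjunct of \<open>eigenvalue_on_ell2\<close>: the operator is a sum
  of four shifts and a bounded multiplication.\<close>

lemma schroedinger_ell2:
  assumes "u \<in> ell2" "\<And>n. \<bar>V n\<bar> \<le> C"
  shows "schroedinger V u \<in> ell2"
proof -
  have "(\<lambda>n. u (n + unit_vec 1) + u (n + - unit_vec 1)
          + (u (n + unit_vec 2) + u (n + - unit_vec 2)) + of_real (V n) * u n) \<in> ell2"
    by (intro ell2_add ell2_shift ell2_bounded_mult[where C = C] assms)
  then show ?thesis
    by (simp add: schroedinger_def adjacency_def)
qed

subsection \<open>Correcting the damped plane wave\<close>

text \<open>The quotient is the future potential. Where \<open>U\<close> vanishes, division by zero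
  gives the value 0, so there the equation has to hold with zero potential; this is what the
  property at zeros of \<open>U\<close> provides.\<close>

lemma exists_corrected_wave:
  fixes lam :: real and m :: nat
  assumes lam: "lam \<in> {-4<..<0} \<union> {0<..<4}"
  obtains U :: "lattice \<Rightarrow> real" and C :: real where "C > 0" "U (0,0) \<noteq> 0"
    "\<And>n. \<bar>U n\<bar> \<le> 1 / bracket n ^ m"
    "\<And>n. U n = 0 \<Longrightarrow> lap U n = lam * U n"
    "\<And>n. \<bar>(lam * U n - lap U n) / U n\<bar> \<le> C / bracket n"
proof -
  obtain p q where pq: "2 * cos p + 2 * cos q = lam" "sin p \<noteq> 0" "sin (2 * p) \<noteq> 0"
    "sin (p + q) \<noteq> 0" "sin (p - q) \<noteq> 0"
    using exists_phases[OF lam] .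
  define \<theta> where "\<theta> = (\<lambda>n::lattice. p * of_int (fst n) + q * of_int (snd n))"
  define c where "c = (\<lambda>n. cos (\<theta> n))"
  \<comment> \<open>These are the thresholds of \<open>abs_cos_add_ge\<close> for the four shifts to
    be separated.\<close>
  define S where "S = {1/2, \<bar>sin p\<bar> / 4, \<bar>sin (2 * p)\<bar> / 4, \<bar>sin (p + q)\<bar> / 4, \<bar>sin (p - q)\<bar> / 4}"
  define \<epsilon> where "\<epsilon> = Min S"
  have \<epsilon>S: "\<epsilon> \<le> s" if "s \<in> S" for s
    unfolding \<epsilon>_def by (rule Min_le) (use that in \<open>auto simp: S_def\<close>)
  have "finite S" "S \<noteq> {}" "\<forall>s\<in>S. s > 0"
    using pq(2-5) by (simp_all add: S_def)
  then have "\<epsilon> > 0"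
    by (simp add: \<epsilon>_def Min_gr_iff)
  moreover have "\<epsilon> \<le> 1/2"
    by (rule \<epsilon>S) (simp add: S_def)
  ultimately have \<epsilon>: "\<epsilon> > 0" "\<epsilon> \<le> 1/2" .
  have \<epsilon>s: "4 * \<epsilon> \<le> \<bar>sin p\<bar>" "4 * \<epsilon> \<le> \<bar>sin (2 * p)\<bar>" "4 * \<epsilon> \<le> \<bar>sin (p + q)\<bar>" "4 * \<epsilon> \<le> \<bar>sin (p - q)\<bar>"
    using \<epsilon>S[of "\<bar>sin p\<bar> / 4"] \<epsilon>S[of "\<bar>sin (2 * p)\<bar> / 4"] \<epsilon>S[of "\<bar>sin (p + q)\<bar> / 4"]
      \<epsilon>S[of "\<bar>sin (p - q)\<bar> / 4"] by (simp_all add: S_def)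
  define bad where "bad = (\<lambda>n. \<bar>c n\<bar> < \<epsilon>)"
  \<comment> \<open>At a bad site \<open>n\<close>, the correction at \<open>n\<close> or at a
    neighbor other than the right one could only come from a bad site \<open>n - d\<close> with one
    of these four \<open>d\<close>.\<close>
  have sep: "\<not> bad (n - d)" if "bad n" "d \<in> {(1,0), (2,0), (1,1), (1,-1)}" for n d
  proof -
    have "4 * \<epsilon> \<le> \<bar>sin (\<theta> d)\<bar>"
      using that(2) \<epsilon>s by (auto simp: \<theta>_def mult.commute)
    then have "4 * \<epsilon> \<le> \<bar>sin (- \<theta> d)\<bar>"
      by simp
    then have "\<epsilon> \<le> \<bar>cos (\<theta> n + (- \<theta> d))\<bar>"
      using that(1) \<epsilon> by (intro abs_cos_add_ge) (auto simp: bad_def c_def)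
    moreover have "\<theta> n + (- \<theta> d) = \<theta> (n - d)"
      by (simp add: \<theta>_def algebra_simps)
    ultimately show ?thesis
      by (simp add: bad_def c_def)
  qed
  have lap_c: "lap c n = lam * c n" for n
  proof -
    have "\<theta> (n + (1,0)) = \<theta> n + p" "\<theta> (n - (1,0)) = \<theta> n - p"
      "\<theta> (n + (0,1)) = \<theta> n + q" "\<theta> (n - (0,1)) = \<theta> n - q"
      by (simp_all add: \<theta>_def algebra_simps)
    then have "lap c n = 2 * cos (\<theta> n) * cos p + 2 * cos (\<theta> n) * cos q"
      by (simp add: lap_def c_def cos_add cos_diff)
    then show ?thesis
      by (simp add: c_def pq(1)[symmetric] algebra_simps)
  qed
  have c1: "\<bar>c n\<bar> \<le> 1" for n
    by (simp add: c_def)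

  \<comment> \<open>In units of \<open>g\<close>, these bound the residual \<open>E\<close> of the
    damped wave, the correction \<open>w\<close> and the final residual \<open>F\<close>. Each move
    to a neighbor costs a factor \<open>2 ^ Suc m\<close>; the 4 in the last term of
    \<open>K2\<close> bounds \<open>|lam|\<close>.\<close>
  define K0 where "K0 = 4 * (real m * 2 ^ Suc m)"
  define K1 where "K1 = K0 * 2 ^ Suc m"
  define K2 where "K2 = K0 + 4 * (K1 * 2 ^ Suc m) + 4 * K1"
  have K: "K0 \<ge> 0" "K1 \<ge> 0" "K2 \<ge> 0"
    by (auto simp: K0_def K1_def K2_def)
  \<comment> \<open>The three lower bounds on \<open>R\<close> serve the one-step estimates, the
    bound \<open>|w| \<le> \<rho>\<close>, and the bound of \<open>|w|\<close> by half of
    \<open>\<epsilon> * \<rho>\<close>, the least size of the wave at good sites.\<close>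
  define R where "R = 2 + K1 + 2 * K1 / \<epsilon>"
  have "2 * K1 / \<epsilon> \<ge> 0" using K \<epsilon> by auto
  then have R: "R \<ge> 2" "R \<ge> K1" "R \<ge> 2 * K1 / \<epsilon>"
    using K unfolding R_def by linarith+
  define a where "a = (\<lambda>n. R + euclid_norm n)"
  have aR: "a n \<ge> R" and a2: "a n \<ge> 2" for n
    using R by (auto simp: a_def euclid_norm_def intro: add_increasing2)
  have ab: "bracket n \<le> a n" for n
    unfolding a_def using R by (intro bracket_le_add_euclid_norm) auto
  define \<rho> where "\<rho> = (\<lambda>n. 1 / a n ^ m)"
  define g where "g = (\<lambda>n. 1 / a n ^ Suc m)"
  have g0: "g n > 0" and \<rho>0: "\<rho> n > 0" for n
    using a2[of n] by (auto simp: g_def \<rho>_def)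
  have g\<rho>: "g n = \<rho> n / a n" for n
    by (simp add: g_def \<rho>_def)
  have astep: "\<bar>a (n + d) - a n\<bar> \<le> 1" if "d \<in> {(1,0), (-1,0), (0,1), (0,-1)}" for n d
    using euclid_norm_unit_step[OF that] by (simp add: a_def)
  have gstep: "g (n + d) \<le> 2 ^ Suc m * g n" if "d \<in> {(1,0), (-1,0), (0,1), (0,-1)}" for n d
    using inverse_power_step(1)[OF a2 astep[OF that], where m = "Suc m"] by (simp add: g_def)
  have \<rho>step: "\<bar>\<rho> (n + d) - \<rho> n\<bar> \<le> (real m * 2 ^ Suc m) * g n" if "d \<in> {(1,0), (-1,0), (0,1), (0,-1)}" for n d
    using inverse_power_step(2)[OF a2 astep[OF that], where m = m] by (simp add: g_def \<rho>_def)

  define E where "E = (\<lambda>n. lap (\<lambda>k. \<rho> k * c k) n - lam * (\<rho> n * c n))"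
  have E: "\<bar>E n\<bar> \<le> K0 * g n" for n
  proof -
    let ?t = "\<lambda>d. (\<rho> (n + d) - \<rho> n) * c (n + d)"
    \<comment> \<open>As \<open>c\<close> solves the equation exactly, only differences of
      \<open>\<rho>\<close> remain.\<close>
    have "E n = lap (\<lambda>k. \<rho> k * c k) n - \<rho> n * lap c n"
      by (simp add: E_def lap_c)
    also have "\<dots> = ?t (1,0) + ?t (-1,0) + ?t (0,1) + ?t (0,-1)"
      by (simp add: lap_plus algebra_simps)
    finally have "\<bar>E n\<bar> \<le> \<bar>?t (1,0)\<bar> + \<bar>?t (-1,0)\<bar> + \<bar>?t (0,1)\<bar> + \<bar>?t (0,-1)\<bar>"
      by linarith
    moreover have "\<bar>?t d\<bar> \<le> (real m * 2 ^ Suc m) * g n" if "d \<in> {(1,0), (-1,0), (0,1), (0,-1)}" for d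
    proof -
      have "\<bar>?t d\<bar> \<le> \<bar>\<rho> (n + d) - \<rho> n\<bar>"
        by (simp add: abs_mult mult_left_le c1)
      with \<rho>step[OF that] show ?thesis by (rule order_trans[rotated])
    qed
    note this[of "(1,0)"] this[of "(-1,0)"] this[of "(0,1)"] this[of "(0,-1)"]
    ultimately show ?thesis
      by (simp add: K0_def)
  qed

  \<comment> \<open>The right neighbor of each bad site receives the negative of the residual
    there.\<close>
  define w where "w = (\<lambda>n. if bad (n - (1,0)) then - E (n - (1,0)) else 0)"
  have w: "\<bar>w n\<bar> \<le> K1 * g n" for n
  proof (cases "bad (n - (1,0))")
    case True
    have "\<bar>w n\<bar> \<le> K0 * g (n + (-1,0))"
      using E[of "n - (1,0)"] True by (cases n) (simp add: w_def)
    also have "\<dots> \<le> K0 * (2 ^ Suc m * g n)"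
      by (intro mult_left_mono gstep K) auto
    finally show ?thesis by (simp add: K1_def)
  qed (use K g0[of n] in \<open>simp add: w_def\<close>)
  have w': "\<bar>w n\<bar> \<le> K1 / a n * \<rho> n" for n
    using w[of n] by (simp add: g\<rho>)
  define u where "u = (\<lambda>n. \<rho> n * c n + w n)"
  define F where "F = (\<lambda>n. lap u n - lam * u n)"
  have F_eq: "F n = E n + lap w n - lam * w n" for n
    by (simp add: F_def u_def E_def lap_add algebra_simps)
  have F: "\<bar>F n\<bar> \<le> K2 * g n" for n
  proof -
    have "\<bar>w (n + d)\<bar> \<le> K1 * 2 ^ Suc m * g n" if "d \<in> {(1,0), (-1,0), (0,1), (0,-1)}" for d
      using w[of "n + d"] mult_left_mono[OF gstep[OF that, of n] K(2)] by (simp add: mult.assoc)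
    note this[of "(1,0)"] this[of "(-1,0)"] this[of "(0,1)"] this[of "(0,-1)"]
    then have "\<bar>lap w n\<bar> \<le> 4 * (K1 * 2 ^ Suc m * g n)"
      by (simp add: lap_plus)
    moreover have "\<bar>lam * w n\<bar> \<le> 4 * (K1 * g n)"
      unfolding abs_mult using lam w by (intro mult_mono) auto
    moreover have "K2 * g n = K0 * g n + 4 * (K1 * 2 ^ Suc m * g n) + 4 * (K1 * g n)"
      by (simp add: K2_def algebra_simps)
    ultimately show ?thesis
      using E[of n] unfolding F_eq by linarith
  qed
  \<comment> \<open>By separation, the only correction seen from \<open>n\<close> is the one at its
    right neighbor, and it cancels \<open>E n\<close>.\<close>
  have F_bad: "F n = 0" if "bad n" for n
  proof -
    have "\<not> bad (n - (1,0))" "\<not> bad (n - (1,0) - (1,0))" "\<not> bad (n + (0,1) - (1,0))"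
      "\<not> bad (n - (0,1) - (1,0))"
      using sep[OF that, of "(1,0)"] sep[OF that, of "(2,0)"] sep[OF that, of "(1,1)"]
        sep[OF that, of "(1,-1)"]
      by (cases n; simp)+
    with that have "lap w n = - E n" "w n = 0"
      by (auto simp: lap_def w_def)
    then show ?thesis
      by (simp add: F_eq)
  qed
  have u_good: "\<epsilon> / 2 * \<rho> n \<le> \<bar>u n\<bar>" if "\<not> bad n" for n
  proof -
    have "2 * K1 / \<epsilon> \<le> a n"
      using R aR[of n] by linarith
    then have "K1 / a n \<le> \<epsilon> / 2"
      using \<epsilon> a2[of n] by (simp add: field_simps)
    then have "K1 / a n * \<rho> n \<le> \<epsilon> / 2 * \<rho> n"
      using \<rho>0[of n] by (intro mult_right_mono) auto
    then have "\<bar>w n\<bar> \<le> \<epsilon> / 2 * \<rho> n"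
      using w'[of n] by linarith
    moreover have "\<epsilon> * \<rho> n \<le> \<bar>\<rho> n * c n\<bar>"
      using that \<rho>0[of n] by (simp add: bad_def abs_mult mult.commute)
    ultimately show ?thesis
      unfolding u_def by linarith
  qed
  have u_upper: "\<bar>u n\<bar> \<le> 2 * \<rho> n" for n
  proof -
    have "K1 / a n \<le> 1"
      using R aR[of n] a2[of n] by simp
    then have "K1 / a n * \<rho> n \<le> 1 * \<rho> n"
      using \<rho>0[of n] by (intro mult_right_mono) auto
    then have "\<bar>w n\<bar> \<le> \<rho> n"
      using w'[of n] by linarith
    moreover have "\<bar>\<rho> n * c n\<bar> \<le> \<rho> n"
      using \<rho>0[of n] c1[of n] by (simp add: abs_mult mult_left_le)
    ultimately show ?thesis
      unfolding u_def by linarith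
  qed
  \<comment> \<open>The summand 1 makes \<open>C\<close> positive.\<close>
  define C where "C = 2 * K2 / \<epsilon> + 1"
  have C0: "2 * K2 / \<epsilon> \<ge> 0"
    using K \<epsilon> by simp
  have quot: "\<bar>F n / u n\<bar> \<le> C / bracket n" for n
  proof (cases "bad n")
    case True
    then show ?thesis
      using C0 bracket_ge_1[of n] by (simp add: F_bad C_def)
  next
    case False
    have "\<bar>F n / u n\<bar> = \<bar>F n\<bar> / \<bar>u n\<bar>"
      by simp
    also have "\<dots> \<le> (K2 * g n) / (\<epsilon> / 2 * \<rho> n)"
      using K g0[of n] by (intro frac_le F u_good False) (auto simp: \<epsilon> \<rho>0)
    also have "\<dots> = (2 * K2 / \<epsilon>) / a n"
      using \<rho>0[of n] \<epsilon> by (simp add: g\<rho> field_simps)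
    also have "\<dots> \<le> C / bracket n"
      using C0 bracket_ge_1[of n] ab[of n] by (intro frac_le) (auto simp: C_def)
    finally show ?thesis .
  qed
  have u_nonzero: "u n \<noteq> 0" if "\<not> bad n" for n
    using u_good[OF that] mult_pos_pos[OF \<epsilon>(1) \<rho>0[of n]] by auto
  show ?thesis
  \<comment> \<open>Halving absorbs the factor 2 in \<open>u_upper\<close> and leaves the quotient
    unchanged.\<close>
  proof (rule that[of C "\<lambda>n. u n / 2"])
    show "C > 0" using C0 by (simp add: C_def)
    have "\<not> bad (0,0)"
      using \<epsilon> by (simp add: bad_def c_def \<theta>_def)
    then show "u (0,0) / 2 \<noteq> 0"
      using u_nonzero by simp
    fix n
    have "\<rho> n \<le> 1 / bracket n ^ m"
      unfolding \<rho>_def using ab[of n] bracket_ge_1[of n] by (intro frac_le power_mono) auto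
    then show "\<bar>u n / 2\<bar> \<le> 1 / bracket n ^ m"
      using u_upper[of n] by simp
    have lap2: "lap (\<lambda>n. u n / 2) n = lap u n / 2"
      by (simp add: lap_def)
    show "lap (\<lambda>n. u n / 2) n = lam * (u n / 2)" if "u n / 2 = 0"
    proof -
      have "F n = 0"
        using that u_nonzero[of n] F_bad[of n] by auto
      then show ?thesis
        by (simp add: lap2 F_def)
    qed
    have "(lam * (u n / 2) - lap (\<lambda>n. u n / 2) n) / (u n / 2) = - (F n / u n)"
      by (simp add: lap2 F_def divide_simps)
    then show "\<bar>(lam * (u n / 2) - lap (\<lambda>n. u n / 2) n) / (u n / 2)\<bar> \<le> C / bracket n"
      using quot[of n] by simp
  qed
qed

section \<open>From the corrected wave to the eigenvalue\<close>

theorem theorem5: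
  fixes lam \<alpha> :: real
  assumes "lam \<in> {-4<..<0} \<union> {0<..<4}"
    and "\<alpha> > 1"
  shows "\<exists>(V :: lattice \<Rightarrow> real) (C :: real) (u :: lattice \<Rightarrow> complex).
           C > 0 \<and> u \<noteq> (\<lambda>n. 0) \<and>
           (\<forall>n. cmod (u n) \<le> bracket n powr (- \<alpha>)) \<and>
           (\<forall>n. \<bar>V n\<bar> \<le> C * bracket n powr (- 1)) \<and>
           schroedinger V u = (\<lambda>n. of_real lam * u n) \<and>
           u \<in> ell2 \<and>
           eigenvalue_on_ell2 (schroedinger V) (of_real lam)"
proof -
  \<comment> \<open>An integer exponent suffices for decay of order \<open>\<alpha>\<close>; since
    \<open>\<alpha> > 1\<close>, it is at least 2, which gives square summability on the plane
    lattice.\<close>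
  define m where "m = nat \<lceil>\<alpha>\<rceil>"
  have m: "\<alpha> \<le> real m" "2 \<le> m"
    using assms(2) unfolding m_def by linarith+
  obtain U C where C: "C > 0" and U0: "U (0,0) \<noteq> 0"
    and U: "\<And>n. \<bar>U n\<bar> \<le> 1 / bracket n ^ m"
    and UZ: "\<And>n. U n = 0 \<Longrightarrow> lap U n = lam * U n"
    and UV: "\<And>n. \<bar>(lam * U n - lap U n) / U n\<bar> \<le> C / bracket n"
    using exists_corrected_wave[OF assms(1), of m] by metis
  define V where "V = (\<lambda>n. (lam * U n - lap U n) / U n)"
  define u where "u = (\<lambda>n. complex_of_real (U n))"
  have b: "bracket n \<ge> 1" "bracket n > 0" for n
    using bracket_ge_1[of n] by auto
  have decay: "cmod (u n) \<le> bracket n powr (- \<alpha>)" for n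
  proof -
    have "cmod (u n) \<le> bracket n powr (- real m)"
      using U[of n] b[of n] by (simp add: u_def powr_minus powr_realpow divide_inverse)
    also have "\<dots> \<le> bracket n powr (- \<alpha>)"
      using b m by (intro powr_mono) auto
    finally show ?thesis .
  qed
  have V: "\<bar>V n\<bar> \<le> C * bracket n powr (- 1)" for n
    using UV[of n] b[of n] by (simp add: V_def powr_minus divide_inverse)
  have eq: "schroedinger V u = (\<lambda>n. of_real lam * u n)"
  proof
    fix n
    have "lap U n + V n * U n = lam * U n"
      using UZ[of n] by (cases "U n = 0") (auto simp: V_def)
    then show "schroedinger V u n = of_real lam * u n"
      unfolding schroedinger_def u_def adjacency_of_real
      by (metis of_real_add of_real_mult)
  qed
  have u2: "u \<in> ell2"
  proof -
    have "(cmod (u n))\<^sup>2 \<le> 1 / bracket n ^ 4" for n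
    proof -
      have "cmod (u n) \<le> 1 / bracket n ^ m"
        using U[of n] by (simp add: u_def)
      also have "\<dots> \<le> 1 / bracket n ^ 2"
        using b[of n] m by (intro frac_le power_increasing) auto
      finally have "(cmod (u n))\<^sup>2 \<le> (1 / bracket n ^ 2)\<^sup>2"
        by (intro power_mono) auto
      then show ?thesis
        by (simp add: power_divide)
    qed
    then show ?thesis
      unfolding ell2_def using summable_on_comparison_test[OF summable_on_bracket] by auto
  qed
  have une: "u \<noteq> (\<lambda>n. 0)"
    using U0 by (auto simp: u_def fun_eq_iff)
  \<comment> \<open>A uniform bound on the potential, so that the operator preserves
    \<open>ell2\<close>.\<close>
  have "\<bar>V n\<bar> \<le> C" for n
  proof -
    have "C / bracket n \<le> C / 1"
      using C b[of n] by (intro divide_left_mono) auto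
    then show ?thesis
      using UV[of n] by (simp add: V_def)
  qed
  then have "eigenvalue_on_ell2 (schroedinger V) (of_real lam)"
    unfolding eigenvalue_on_ell2_def using schroedinger_ell2 u2 une eq by blast
  with C une decay V eq u2 show ?thesis
    by blast
qed

end
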